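(* For $i\in\{1,2,\dots,m\}$, let $f_i:\mathbb{R}^n\to\mathbb{R}\cup\{+\infty\}$ be proper, lower semicontinuous and prox-bounded with threshold $r_i$. Let $f$ be a piecewise function with pieces $f_1,\dots,f_m$ on sets $S_1,\dots,S_m$. Then $f$ is prox-bounded with threshold $\bar r\le\max_{1\le i\le m} r_i$.
   Context: $\mathbb{R}^n$ is equipped with an inner product and the induced norm $\|\cdot\|$. For $f:\mathbb{R}^n\to\mathbb{R}\cup\{+\infty\}$ and $r\ge 0$, the Moreau envelope of $f$ is $e_rf(x)=\inf_{y\in\mathbb{R}^n}\{f(y)+\frac r2\|y-x\|^2\}$. The function $f$ is prox-bounded if there exists $r\ge0$ such that $e_rf(x)>-\infty$ for some $x\in\mathbb{R}^n$; the infimum of all such $r\ge 0$ is called the threshold of prox-boundedness of $f$. Proper means not identically $+\infty$ and never $-\infty$. The indicator function of a set $S$ is $\iota_S(x)=0$ if $x\in S$ and $\iota_S(x)=+\infty$ if $x\notin S$. Piecewise function: given proper functions $f_i:\mathbb{R}^n\to\mathbb{R}\cup\{+\infty\}$, $i\in\{1,\dots,m\}$, and sets $S_1,\dots,S_m\subseteq\mathbb{R}^n$ with $\bigcup_i S_i=\mathbb{R}^n$ and $S_i\cap\operatorname{int}S_j=\varnothing$ for $i\ne j$, the piecewise function $f$ is defined by $f(x)=f_i(x)$ for $x\in S_i$. It is not required that $f_i=f_j$ on $S_i\cap S_j$; at points lying in several $S_i$ the value is the smallest of the corresponding $f_i(x)$, i.e. $f=\min_{1\le i\le m}(f_i+\iota_{S_i})$.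 *)

theory Defs
  imports "HOL-Analysis.Analysis"
begin

text \<open>
  The space R^n with its inner product is a type of class \<^class>\<open>euclidean_space\<close>. Functions with
  values in R with +infinity adjoined are functions into \<^typ>\<open>ereal\<close>; \<open>proper_fun\<close> excludes
  the value -infinity.
\<close>

definition proper_fun :: "('a \<Rightarrow> ereal) \<Rightarrow> bool" where
  "proper_fun f \<longleftrightarrow> (\<exists>x. f x \<noteq> \<infinity>) \<and> (\<forall>x. f x \<noteq> -\<infinity>)"

definition lower_semicontinuous :: "('a::topological_space \<Rightarrow> ereal) \<Rightarrow> bool" where
  "lower_semicontinuous f \<longleftrightarrow> (\<forall>x. f x \<le> Liminf (at x) f)"

definition moreau_envelope :: "real \<Rightarrow> ('a::real_inner \<Rightarrow> ereal) \<Rightarrow> 'a \<Rightarrow> ereal" where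
  "moreau_envelope r f x = (INF y. f y + ereal (r / 2 * (norm (y - x))\<^sup>2))"

definition prox_parameters :: "('a::real_inner \<Rightarrow> ereal) \<Rightarrow> real set" where
  "prox_parameters f = {r. 0 \<le> r \<and> (\<exists>x. moreau_envelope r f x > -\<infinity>)}"

definition prox_bounded :: "('a::real_inner \<Rightarrow> ereal) \<Rightarrow> bool" where
  "prox_bounded f \<longleftrightarrow> prox_parameters f \<noteq> {}"

text \<open>
  The infimum is taken in the reals. It is the true infimum if \<open>f\<close> is prox-bounded, since
  \<open>prox_parameters f\<close> is bounded below by 0, and is unspecified otherwise.
\<close>

definition prox_threshold :: "('a::real_inner \<Rightarrow> ereal) \<Rightarrow> real" where
  "prox_threshold f = Inf (prox_parameters f)"

definition set_indicator :: "'a set \<Rightarrow> 'a \<Rightarrow> ereal" where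
  "set_indicator S x = (if x \<in> S then 0 else \<infinity>)"

text \<open>
  The covering condition forces \<open>1 \<le> m\<close>, so the minimum is over a nonempty finite set.
  The pieces need not agree on the overlaps of the sets, where the smallest value is taken.
\<close>

definition piecewise_fun ::
  "('a::topological_space \<Rightarrow> ereal) \<Rightarrow> nat \<Rightarrow> (nat \<Rightarrow> 'a \<Rightarrow> ereal) \<Rightarrow> (nat \<Rightarrow> 'a set) \<Rightarrow> bool" where
  "piecewise_fun f m fs S \<longleftrightarrow>
     (\<forall>i\<in>{1..m}. proper_fun (fs i)) \<and>
     (\<Union>i\<in>{1..m}. S i) = UNIV \<and>
     (\<forall>i\<in>{1..m}. \<forall>j\<in>{1..m}. i \<noteq> j \<longrightarrow> S i \<inter> interior (S j) = {}) \<and>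
     (\<forall>x. f x = Min ((\<lambda>i. fs i x + set_indicator (S i) x) ` {1..m}))"

end

theory Submission
  imports Defs
begin

text \<open>
  The envelope \<open>e\<^sub>r f\<close> exceeds \<open>-\<infinity>\<close> at \<open>x\<close> exactly when \<open>f\<close> lies above the concave
  quadratic \<open>y \<mapsto> c - r/2 \<parallel>y - x\<parallel>\<^sup>2\<close> for some real \<open>c\<close>. Moving the centre \<open>x\<close> changes
  the quadratic only by a term that is affine in \<open>y\<close>, and such a term is absorbed by any increase
  of \<open>r\<close> (lemma \<open>quadratic_minorant_recentre\<close>). Hence every \<open>s\<close> beyond the threshold of
  \<open>f\<close> gives a minorant centred at any prescribed point
  (lemma \<open>minorant_beyond_prox_threshold\<close>).

  For a piecewise function, take \<open>s\<close> beyond all thresholds of the pieces and centre all the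
  minorants at the origin. They then differ only in their constants, so the one with the smallest
  constant lies below every piece, hence below the minimum that defines the piecewise function. So
  every \<open>s\<close> greater than the largest threshold is a prox-parameter of the piecewise function.
  The recentring is essential, since a prox-parameter of each piece comes with its own centre.
\<close>

lemma moreau_envelope_gt_iff_quadratic_minorant:
  "moreau_envelope r f x > -\<infinity> \<longleftrightarrow>
     (\<exists>c. \<forall>y. ereal (c - r / 2 * (norm (y - x))\<^sup>2) \<le> f y)"
proof -
  have "moreau_envelope r f x > -\<infinity> \<longleftrightarrow> (\<exists>c. ereal c \<le> moreau_envelope r f x)"
    by (cases "moreau_envelope r f x") auto
  also have "\<dots> \<longleftrightarrow> (\<exists>c. \<forall>y. ereal c \<le> f y + ereal (r / 2 * (norm (y - x))\<^sup>2))"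
    by (simp add: moreau_envelope_def le_INF_iff)
  also have "\<dots> \<longleftrightarrow> (\<exists>c. \<forall>y. ereal (c - r / 2 * (norm (y - x))\<^sup>2) \<le> f y)"
  proof -
    have "ereal c \<le> a + ereal b \<longleftrightarrow> ereal (c - b) \<le> a" for a b c
      by (cases a) auto
    then show ?thesis by simp
  qed
  finally show ?thesis .
qed

text \<open>
  With \<open>t = \<parallel>y - z\<parallel>\<close> and \<open>d = \<parallel>z - x\<parallel>\<close> the triangle inequality reduces the claim to
  a lower bound for \<open>s t\<^sup>2 - q (t + d)\<^sup>2\<close>, a polynomial in \<open>t\<close> with leading coefficient
  \<open>s - q > 0\<close>.
\<close>

lemma quadratic_minorant_recentre:
  fixes f :: "'a::real_inner \<Rightarrow> ereal"
  assumes "0 \<le> q" "q < s"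
    and minorant: "\<And>y. ereal (c - q / 2 * (norm (y - x))\<^sup>2) \<le> f y"
  obtains c' where "\<And>y. ereal (c' - s / 2 * (norm (y - z))\<^sup>2) \<le> f y"
proof
  fix y
  define t d where "t = norm (y - z)" and "d = norm (z - x)"
  \<comment> \<open>the constant is what remains after completing the square in \<open>t\<close>\<close>
  let ?c' = "c - (q * d)\<^sup>2 / (2 * (s - q)) - q * d\<^sup>2 / 2"
  have "norm (y - x) \<le> t + d"
    unfolding t_def d_def using norm_triangle_ineq[of "y - z" "z - x"] by simp
  then have "q / 2 * (norm (y - x))\<^sup>2 \<le> q / 2 * (t + d)\<^sup>2"
    using \<open>0 \<le> q\<close> by (intro mult_left_mono power_mono) auto
  moreover have "s / 2 * t\<^sup>2 - q / 2 * (t + d)\<^sup>2 + (q * d)\<^sup>2 / (2 * (s - q)) + q * d\<^sup>2 / 2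
      = ((s - q) * t - q * d)\<^sup>2 / (2 * (s - q))"
  proof -
    define k where "k = s - q"
    have "s = q + k" and "k \<noteq> 0"
      using \<open>q < s\<close> by (auto simp: k_def)
    then show ?thesis
      by (simp add: field_simps power2_eq_square)
  qed
  moreover have "0 \<le> ((s - q) * t - q * d)\<^sup>2 / (2 * (s - q))"
    using \<open>q < s\<close> by simp
  ultimately have "?c' - s / 2 * t\<^sup>2 \<le> c - q / 2 * (norm (y - x))\<^sup>2"
    by linarith
  then show "ereal (c - (q * norm (z - x))\<^sup>2 / (2 * (s - q)) - q * (norm (z - x))\<^sup>2 / 2
      - s / 2 * (norm (y - z))\<^sup>2) \<le> f y"
    using minorant[of y] unfolding t_def d_def by (meson ereal_less_eq(3) order_trans)
qed

lemma minorant_beyond_prox_threshold: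
  fixes f :: "'a::real_inner \<Rightarrow> ereal"
  assumes "prox_bounded f" "prox_threshold f < s"
  obtains c where "\<And>y. ereal (c - s / 2 * (norm (y - z))\<^sup>2) \<le> f y"
proof -
  obtain q where q: "q \<in> prox_parameters f" "q < s"
    using assms cInf_lessD unfolding prox_bounded_def prox_threshold_def by blast
  then obtain x c where "\<And>y. ereal (c - q / 2 * (norm (y - x))\<^sup>2) \<le> f y"
    unfolding prox_parameters_def moreau_envelope_gt_iff_quadratic_minorant by auto
  moreover have "0 \<le> q"
    using q(1) by (simp add: prox_parameters_def)
  ultimately show ?thesis
    using quadratic_minorant_recentre[of q s c x f z] q(2) that by blast
qed

lemma prox_threshold_nonneg:
  "prox_bounded f \<Longrightarrow> 0 \<le> prox_threshold f"
  unfolding prox_bounded_def prox_threshold_def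
  by (intro cInf_greatest) (auto simp: prox_parameters_def)

lemma prox_bounded_threshold_leI:
  assumes "\<And>s. R < s \<Longrightarrow> s \<in> prox_parameters f"
  shows "prox_bounded f \<and> prox_threshold f \<le> R"
proof
  show "prox_bounded f"
    unfolding prox_bounded_def using assms[of "R + 1"] by auto
  have "bdd_below (prox_parameters f)"
    by (rule bdd_belowI[of _ 0]) (simp add: prox_parameters_def)
  then show "prox_threshold f \<le> R"
    unfolding prox_threshold_def using assms by (blast intro: dense_ge cInf_lower)
qed

lemma piecewise_fun_nonempty:
  "piecewise_fun f m fs S \<Longrightarrow> {1..m} \<noteq> {}"
  unfolding piecewise_fun_def by auto

lemma piecewise_fun_ge_some_piece:
  assumes "piecewise_fun f m fs S"
  obtains i where "i \<in> {1..m}" "fs i x \<le> f x"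
proof -
  have "f x = Min ((\<lambda>i. fs i x + set_indicator (S i) x) ` {1..m})"
    using assms unfolding piecewise_fun_def by blast
  then have "f x \<in> (\<lambda>i. fs i x + set_indicator (S i) x) ` {1..m}"
    using piecewise_fun_nonempty[OF assms] by (simp only:) (intro Min_in; simp)
  then obtain i where "i \<in> {1..m}" "f x = fs i x + set_indicator (S i) x"
    by blast
  moreover have "fs i x \<le> fs i x + set_indicator (S i) x"
    by (simp add: set_indicator_def)
  ultimately show ?thesis
    using that by simp
qed

theorem theorem3p4:
  fixes f :: "'a::euclidean_space \<Rightarrow> ereal"
    and fs :: "nat \<Rightarrow> 'a \<Rightarrow> ereal"
    and S :: "nat \<Rightarrow> 'a set"
    and r :: "nat \<Rightarrow> real"
    and m :: nat
  assumes "\<And>i. i \<in> {1..m} \<Longrightarrow> proper_fun (fs i)"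
    and "\<And>i. i \<in> {1..m} \<Longrightarrow> lower_semicontinuous (fs i)"
    and "\<And>i. i \<in> {1..m} \<Longrightarrow> prox_bounded (fs i)"
    and "\<And>i. i \<in> {1..m} \<Longrightarrow> prox_threshold (fs i) = r i"
    and "piecewise_fun f m fs S"
  shows "prox_bounded f \<and> prox_threshold f \<le> Max (r ` {1..m})"
proof (rule prox_bounded_threshold_leI)
  fix s
  assume s: "Max (r ` {1..m}) < s"
  have nonempty: "{1..m} \<noteq> {}"
    using assms(5) by (rule piecewise_fun_nonempty)
  have r_less: "r i < s" if "i \<in> {1..m}" for i
    using s that by (meson Max_ge finite_atLeastAtMost finite_imageI imageI le_less_trans)
  obtain i\<^sub>0 where "i\<^sub>0 \<in> {1..m}"
    using nonempty by blast
  then have "0 \<le> r i\<^sub>0" and "r i\<^sub>0 < s"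
    using prox_threshold_nonneg[OF assms(3)] assms(4) r_less by simp_all
  then have "0 \<le> s"
    by simp
  have "\<exists>c. \<forall>y. ereal (c - s / 2 * (norm (y - 0))\<^sup>2) \<le> fs i y" if "i \<in> {1..m}" for i
  proof -
    have "prox_threshold (fs i) < s"
      using assms(4) r_less that by simp
    from minorant_beyond_prox_threshold[OF assms(3)[OF that] this, of 0] show ?thesis
      by blast
  qed
  then obtain c where c: "\<And>i y. i \<in> {1..m} \<Longrightarrow> ereal (c i - s / 2 * (norm (y - 0))\<^sup>2) \<le> fs i y"
    by metis
  have "ereal (Min (c ` {1..m}) - s / 2 * (norm (y - 0))\<^sup>2) \<le> f y" for y
  proof -
    obtain i where i: "i \<in> {1..m}" "fs i y \<le> f y"
      using piecewise_fun_ge_some_piece[OF assms(5)] by blast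
    have "Min (c ` {1..m}) \<le> c i"
      using i(1) by simp
    then have "ereal (Min (c ` {1..m}) - s / 2 * (norm (y - 0))\<^sup>2)
        \<le> ereal (c i - s / 2 * (norm (y - 0))\<^sup>2)"
      by simp
    also have "\<dots> \<le> fs i y"
      using i(1) by (rule c)
    finally show ?thesis
      using i(2) by simp
  qed
  then have "moreau_envelope s f 0 > -\<infinity>"
    unfolding moreau_envelope_gt_iff_quadratic_minorant by blast
  then show "s \<in> prox_parameters f"
    using \<open>0 \<le> s\<close> unfolding prox_parameters_def by blast
qed

end
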